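(* Let $T$ be a tree and let $\ell>3$ be an integer. Then $\chi_s'(T\Box C_{2\ell})\le 2\Delta(T)+5$, where $C_{2\ell}$ is the cycle of length $2\ell$.
   Context: $\Delta(T)$ is the maximum degree of $T$. The Cartesian product $G\Box H$ has vertex set $V(G)\times V(H)$, with $(a,u)\sim(b,v)$ iff either $a=b$ and $uv\in E(H)$, or $u=v$ and $ab\in E(G)$. A strong edge coloring is a proper edge coloring in which every color class is an induced matching; $\chi_s'(G)$ is the minimum number of colors in such a coloring. *)

theory Defs
  imports "Graph_Theory.Graph_Theory"
begin

text \<open>
  A finite simple graph is a \<^locale>\<open>pair_graph\<close>, i.e. a finite, symmetric, loop-free digraph
  whose arcs are ordered pairs. The undirected edge $uv$ is represented by the two arcs
  $(u,v)$ and $(v,u)$.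
\<close>

definition uedges :: "'a pair_pre_digraph \<Rightarrow> 'a set set" where
  "uedges G = {{u, v} | u v. (u, v) \<in> parcs G}"

text \<open>
  The library predicate \<^const>\<open>tree\<close> is meant for directed graphs: in a symmetric digraph, every
  edge gives rise to the directed cycle $u \to v \to u$ of length two. The cycles of length at
  least three are exactly the cycles of the undirected graph.
\<close>

definition undirected_tree :: "'a pair_pre_digraph \<Rightarrow> bool" where
  "undirected_tree T \<longleftrightarrow> pair_graph T \<and> connected (with_proj T) \<and>
     \<not> (\<exists>p. pre_digraph.cycle (with_proj T) p \<and> 3 \<le> length p)"

text \<open>In a symmetric digraph the out-degree of a vertex is its undirected degree.\<close>

definition max_degree :: "'a pair_pre_digraph \<Rightarrow> nat" where
  "max_degree G = Max (out_degree (with_proj G) ` pverts G)"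

definition cycle_graph :: "nat \<Rightarrow> nat pair_pre_digraph" where
  "cycle_graph n = \<lparr> pverts = {..<n},
     parcs = {(i, j). i < n \<and> j < n \<and> (j = (i + 1) mod n \<or> i = (j + 1) mod n)} \<rparr>"

definition cartesian_product ::
    "'a pair_pre_digraph \<Rightarrow> 'b pair_pre_digraph \<Rightarrow> ('a \<times> 'b) pair_pre_digraph"
    (infixl \<open>\<box>\<close> 70) where
  "G \<box> H = \<lparr> pverts = pverts G \<times> pverts H,
     parcs = {((a, u), (b, v)). (a, u) \<in> pverts G \<times> pverts H \<and> (b, v) \<in> pverts G \<times> pverts H \<and>
       (a = b \<and> (u, v) \<in> parcs H \<or> u = v \<and> (a, b) \<in> parcs G)} \<rparr>"

definition matching :: "'a pair_pre_digraph \<Rightarrow> 'a set set \<Rightarrow> bool" where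
  "matching G M \<longleftrightarrow> M \<subseteq> uedges G \<and> (\<forall>e\<in>M. \<forall>f\<in>M. e \<noteq> f \<longrightarrow> e \<inter> f = {})"

text \<open>
  A matching is induced if it is the whole edge set of the subgraph induced by the vertices
  it covers.
\<close>

definition induced_matching :: "'a pair_pre_digraph \<Rightarrow> 'a set set \<Rightarrow> bool" where
  "induced_matching G M \<longleftrightarrow> matching G M \<and> {e \<in> uedges G. e \<subseteq> \<Union>M} = M"

definition proper_edge_coloring :: "'a pair_pre_digraph \<Rightarrow> ('a set \<Rightarrow> 'c) \<Rightarrow> bool" where
  "proper_edge_coloring G c \<longleftrightarrow>
     (\<forall>e\<in>uedges G. \<forall>f\<in>uedges G. e \<noteq> f \<and> e \<inter> f \<noteq> {} \<longrightarrow> c e \<noteq> c f)"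

definition strong_edge_coloring :: "'a pair_pre_digraph \<Rightarrow> ('a set \<Rightarrow> 'c) \<Rightarrow> bool" where
  "strong_edge_coloring G c \<longleftrightarrow> proper_edge_coloring G c \<and>
     (\<forall>k. induced_matching G {e \<in> uedges G. c e = k})"

definition strong_chromatic_index :: "'a pair_pre_digraph \<Rightarrow> nat" where
  "strong_chromatic_index G =
     (LEAST k. \<exists>c :: 'a set \<Rightarrow> nat. strong_edge_coloring G c \<and> c ` uedges G \<subseteq> {..<k})"

text \<open>
  The least number of colours is attained for every finite simple graph, and the graphs
  considered here are finite and simple.
\<close>

lemma finite_uedges:
  assumes "finite (parcs G)"
  shows "finite (uedges G)"
proof -
  have "uedges G = (\<lambda>(u, v). {u, v}) ` parcs G"
    by (auto simp: uedges_def)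
  then show ?thesis using assms by simp
qed

lemma strong_chromatic_index_attained:
  assumes "pair_graph (G :: 'a pair_pre_digraph)"
  shows "\<exists>c :: 'a set \<Rightarrow> nat. strong_edge_coloring G c \<and>
           c ` uedges G \<subseteq> {..<strong_chromatic_index G}"
proof -
  interpret pair_graph G by fact
  have "finite (uedges G)"
    by (intro finite_uedges pair_finite_arcs)
  then obtain c :: "'a set \<Rightarrow> nat" where "bij_betw c (uedges G) {0..<card (uedges G)}"
    using ex_bij_betw_finite_nat by metis
  then have inj: "inj_on c (uedges G)" and im: "c ` uedges G \<subseteq> {..<card (uedges G)}"
    by (auto simp: bij_betw_def)
  have "induced_matching G {e \<in> uedges G. c e = k}" for k
  proof (cases "\<exists>e\<in>uedges G. c e = k")
    case False
    then have *: "{e \<in> uedges G. c e = k} = {}" by auto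
    show ?thesis unfolding * by (auto simp: induced_matching_def matching_def uedges_def)
  next
    case True
    then obtain e where e: "e \<in> uedges G" "c e = k" by blast
    then have *: "{e \<in> uedges G. c e = k} = {e}"
      using inj by (auto simp: inj_on_def)
    have "f = e" if f: "f \<in> uedges G" "f \<subseteq> e" for f
    proof -
      obtain u v where "e = {u, v}" using e by (auto simp: uedges_def)
      moreover obtain x y where "f = {x, y}" and xy: "(x, y) \<in> parcs G"
        using f(1) by (auto simp: uedges_def)
      moreover have "x \<noteq> y"
        using pair_no_loops[OF xy] by simp
      ultimately show ?thesis using f(2) by auto
    qed
    then show ?thesis
      unfolding * using e by (auto simp: induced_matching_def matching_def)
  qed
  moreover have "proper_edge_coloring G c"
    using inj by (auto simp: proper_edge_coloring_def inj_on_def)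
  ultimately have "strong_edge_coloring G c"
    by (simp add: strong_edge_coloring_def)
  then have "\<exists>c :: 'a set \<Rightarrow> nat. strong_edge_coloring G c \<and> c ` uedges G \<subseteq> {..<card (uedges G)}"
    using im by blast
  then show ?thesis
    unfolding strong_chromatic_index_def by (rule LeastI)
qed

lemma pair_graph_cycle_graph:
  assumes "3 \<le> n"
  shows "pair_graph (cycle_graph n)"
proof
  show "finite (parcs (cycle_graph n))"
    by (rule finite_subset[of _ "{..<n} \<times> {..<n}"]) (auto simp: cycle_graph_def)
  show "symmetric (with_proj (cycle_graph n))"
    by (auto simp: symmetric_def sym_def arcs_ends_def arc_to_ends_def cycle_graph_def)
  show "fst e \<noteq> snd e" if "e \<in> parcs (cycle_graph n)" for e
  proof -
    have "i \<noteq> (i + 1) mod n" if "i < n" for i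
      using that assms by (cases "i + 1 = n") auto
    then show ?thesis using that by (fastforce simp: cycle_graph_def)
  qed
qed (auto simp: cycle_graph_def)

lemma pair_graph_cartesian_product:
  assumes "pair_graph G" and "pair_graph H"
  shows "pair_graph (G \<box> H)"
proof -
  interpret G: pair_graph G by fact
  interpret H: pair_graph H by fact
  have symG: "(b, a) \<in> parcs G" if "(a, b) \<in> parcs G" for a b
    using G.pair_sym_arcs that by (force simp: symmetric_def sym_def arcs_ends_def arc_to_ends_def)
  have symH: "(b, a) \<in> parcs H" if "(a, b) \<in> parcs H" for a b
    using H.pair_sym_arcs that by (force simp: symmetric_def sym_def arcs_ends_def arc_to_ends_def)
  show ?thesis
  proof
    show "finite (pverts (G \<box> H))"
      by (simp add: cartesian_product_def G.pair_finite_verts H.pair_finite_verts)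
    show "finite (parcs (G \<box> H))"
      by (rule finite_subset[of _ "(pverts G \<times> pverts H) \<times> (pverts G \<times> pverts H)"])
        (auto simp: cartesian_product_def G.pair_finite_verts H.pair_finite_verts)
    show "symmetric (with_proj (G \<box> H))"
      by (auto simp: symmetric_def sym_def arcs_ends_def arc_to_ends_def cartesian_product_def
          dest: symG symH)
    show "fst e \<noteq> snd e" if "e \<in> parcs (G \<box> H)" for e
      using that G.pair_no_loops H.pair_no_loops by (fastforce simp: cartesian_product_def)
  qed (auto simp: cartesian_product_def)
qed

end

theory Submission
  imports Defs
begin

text \<open>
  The edges inside the copies of $T$ get $2\Delta(T)$ colours and the edges inside the copies of
  the cycle get five further colours. For the former, take a proper edge colouring $\varphi$ of $T$
  with $\Delta(T)$ colours and split every colour into two shades; the copy of $e$ at level $i$ has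
  colour $\varphi(e)$, and its shade alternates with the parity of $i$. Edges $ab$ and $cd$ with
  $\varphi(ab) = \varphi(cd)$ and $b$ adjacent to $c$ get opposite shades at the same level: the shade
  a vertex assigns to a colour $k$ is flipped along every edge whose colour is not $k$, which is
  consistent since $T$ has no cycles. For the latter, write $2\ell = 4p + 5q$ and concatenate $p$
  blocks $0123$ and $q$ blocks $01234$ to a cyclic word in which any four consecutive letters
  differ. The vertices in one class of the bipartition of $T$ use this word on their copy of the
  cycle, the others use it shifted by two places, so that edges over adjacent vertices of $T$
  which are at most one step apart have letters one to three places apart.
\<close>

section \<open>Strong colourings from functions on arcs\<close>

text \<open>Two edges of one colour violate strongness exactly when some end of one equals or is
  adjacent to some end of the other. As \<open>f\<close> is symmetric, both edges can be read
  starting at these ends, so \<open>conflict\<close> compares first ends only.\<close>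

lemma strong_chromatic_index_leI:
  fixes G :: "'a pair_pre_digraph" and f :: "'a \<Rightarrow> 'a \<Rightarrow> nat"
  assumes "pair_graph G"
    and sym: "\<And>u v. (u, v) \<in> parcs G \<Longrightarrow> f u v = f v u"
    and bound: "\<And>u v. (u, v) \<in> parcs G \<Longrightarrow> f u v < k"
    and conflict: "\<And>u v x y. \<lbrakk>(u, v) \<in> parcs G; (x, y) \<in> parcs G; u = x \<or> (u, x) \<in> parcs G;
      f u v = f x y\<rbrakk> \<Longrightarrow> {u, v} = {x, y}"
  shows "strong_chromatic_index G \<le> k"
proof -
  interpret pair_graph G by fact
  \<comment> \<open>An edge comes from just two arcs, on which \<open>f\<close> agrees by
    \<open>sym\<close>, so the description is unique.\<close>
  define c where "c e = (THE k. \<exists>u v. (u, v) \<in> parcs G \<and> e = {u, v} \<and> k = f u v)" for e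
  have c: "c {u, v} = f u v" if "(u, v) \<in> parcs G" for u v
    unfolding c_def using that sym by (intro the_equality) (auto simp: doubleton_eq_iff)
  have edgeE: "\<exists>v. (u, v) \<in> parcs G \<and> e = {u, v}" if "e \<in> uedges G" "u \<in> e" for e u
    using that by (auto simp: uedges_def insert_commute intro: arcs_symmetric)
  have eq: "e = g" if e: "e \<in> uedges G" "g \<in> uedges G" and u: "u \<in> e" "x \<in> g"
    and ux: "u = x \<or> (u, x) \<in> parcs G" and cc: "c e = c g" for e g u x
  proof -
    obtain v y where vy: "(u, v) \<in> parcs G" "e = {u, v}" "(x, y) \<in> parcs G" "g = {x, y}"
      using edgeE e u by meson
    then show ?thesis using conflict[of u v x y] ux cc c by auto
  qed
  have "proper_edge_coloring G c"
    unfolding proper_edge_coloring_def using eq by blast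
  moreover have "induced_matching G {e \<in> uedges G. c e = k}" for k
    unfolding induced_matching_def matching_def
  proof (intro conjI)
    let ?M = "{e \<in> uedges G. c e = k}"
    show "\<forall>e\<in>?M. \<forall>g\<in>?M. e \<noteq> g \<longrightarrow> e \<inter> g = {}" using eq by blast
    \<comment> \<open>An edge \<open>h\<close> covered by the class joins an end of \<open>e\<close>
      to an end of \<open>g\<close>; then \<open>eq\<close> forces \<open>e = g\<close>, which
      contains both ends of \<open>h\<close> and so equals it.\<close>
    show "{e \<in> uedges G. e \<subseteq> \<Union> ?M} = ?M"
    proof (intro equalityI subsetI)
      fix h assume "h \<in> {e \<in> uedges G. e \<subseteq> \<Union> ?M}"
      then have "h \<in> uedges G" "h \<subseteq> \<Union> ?M" by auto
      moreover obtain u v where "h = {u, v}" "(u, v) \<in> parcs G"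
        using \<open>h \<in> uedges G\<close> by (auto simp: uedges_def)
      moreover obtain e g where "e \<in> ?M" "u \<in> e" "g \<in> ?M" "v \<in> g"
        using \<open>h \<subseteq> \<Union> ?M\<close> \<open>h = {u, v}\<close> by blast
      ultimately have h: "h = {u, v}" "(u, v) \<in> parcs G" "h \<in> uedges G"
        and eg: "e \<in> ?M" "g \<in> ?M" "u \<in> e" "v \<in> g"
        by auto
      then have "e = g" using eq[of e g u v] by auto
      moreover obtain y where "e = {u, y}" using edgeE eg by blast
      moreover have "u \<noteq> v" using no_loops' h by blast
      ultimately have "h = e" using h eg by auto
      then show "h \<in> ?M" using eg by auto
    qed auto
  qed auto
  ultimately have "strong_edge_coloring G c" by (simp add: strong_edge_coloring_def)
  moreover have "c ` uedges G \<subseteq> {..<k}"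
    using bound c by (auto simp: uedges_def)
  ultimately show ?thesis
    unfolding strong_chromatic_index_def by (intro Least_le) blast
qed

section \<open>Growing a tree leaf by leaf\<close>

text \<open>The last premise of \<open>insert\<close> makes \<open>b\<close> a leaf over
  \<open>W\<close>. It holds because \<open>W\<close> is kept connected by paths inside itself: a
  second neighbour of \<open>b\<close> in \<open>W\<close> would close a cycle.\<close>

lemma undirected_tree_induct [consumes 1, case_names singleton insert]:
  assumes T: "undirected_tree T"
    and singleton: "\<And>r. r \<in> pverts T \<Longrightarrow> P {r}"
    and insert: "\<And>W a b. \<lbrakk>W \<subseteq> pverts T; P W; a \<in> W; b \<in> pverts T - W; (a, b) \<in> parcs T;
      \<And>c. \<lbrakk>c \<in> W; (c, b) \<in> parcs T\<rbrakk> \<Longrightarrow> c = a\<rbrakk> \<Longrightarrow> P (insert b W)"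
  shows "P (pverts T)"
proof -
  interpret pair_graph T using T by (simp add: undirected_tree_def)
  have no_cycle: "length p < 3" if "cycle p" for p
    using T that by (force simp: undirected_tree_def)
  have "connected (with_proj T)" using T by (simp add: undirected_tree_def)
  then have conn: "strongly_connected (with_proj T)"
    using symmetric_connected_imp_strongly_connected sym_arcs by blast
  define pathconn where "pathconn W \<longleftrightarrow>
    (\<forall>u\<in>W. \<forall>v\<in>W. \<exists>p. apath u p v \<and> set (pawalk_verts u p) \<subseteq> W)" for W
  have extend: "P (pverts T)"
    if "W \<subseteq> pverts T" "W \<noteq> {}" "P W" "pathconn W" for W
    using that
  proof (induction "card (pverts T - W)" arbitrary: W rule: less_induct)
    case less
    show ?case
    proof (cases "W = pverts T")
      case True
      then show ?thesis using less.prems by simp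
    next
      case False
      obtain r v where rv: "r \<in> W" "v \<in> pverts T" "v \<notin> W" using less.prems False by blast
      \<comment> \<open>If no arc left \<open>W\<close>, a walk from \<open>r\<close> could never
        reach \<open>v\<close>.\<close>
      have "\<exists>a b. a \<in> W \<and> b \<notin> W \<and> (a, b) \<in> parcs T"
      proof (rule ccontr)
        assume no: "\<nexists>a b. a \<in> W \<and> b \<notin> W \<and> (a, b) \<in> parcs T"
        have "r \<rightarrow>\<^sup>*\<^bsub>with_proj T\<^esub> v"
          using conn rv less.prems by (auto simp: strongly_connected_def)
        then obtain p where p: "awalk r p v" by (auto simp: reachable_awalk)
        have "v \<in> W" if "awalk u p v" "u \<in> W" for u p
          using that
        proof (induction p arbitrary: u)
          case (Cons e p)
          then show ?case using no by (cases e) (auto simp: awalk_Cons_iff)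
        qed (auto simp: awalk_Nil_iff)
        then show False using p rv by blast
      qed
      then obtain a b where ab: "a \<in> W" "b \<notin> W" "(a, b) \<in> parcs T" by blast
      then have ba: "(b, a) \<in> parcs T" and bV: "b \<in> pverts T"
        by (auto intro: arcs_symmetric dest: in_arcsD2)
      have uniq: "c = a" if c: "c \<in> W" "(c, b) \<in> parcs T" for c
      proof (rule ccontr)
        assume "c \<noteq> a"
        obtain p where p: "apath a p c" "set (pawalk_verts a p) \<subseteq> W"
          using less.prems(4) c ab unfolding pathconn_def by meson
        then have "p \<noteq> []" using \<open>c \<noteq> a\<close> by (auto simp: apath_Nil_iff)
        \<comment> \<open>From \<open>b\<close> to \<open>a\<close>, through \<open>W\<close> to
          \<open>c\<close>, and back to \<open>b\<close>. As \<open>p\<close> is nonempty, the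
          length is at least three, so this is not merely an edge traversed back and forth.\<close>
        let ?q = "(b, a) # p @ [(c, b)]"
        have w: "awalk a p c" "distinct (pawalk_verts a p)" using p by (auto simp: apath_def)
        have "awalk b ?q b"
          using w ba c bV by (auto simp: awalk_simps)
        moreover have "pawalk_verts a (p @ [(c, b)]) = pawalk_verts a p @ [b]"
          using \<open>awalk b ?q b\<close> by (subst awalk_verts_append[where u=a and v=b]) 
            (use w in \<open>auto simp: awalk_simps\<close>)
        then have "distinct (tl (pawalk_verts b ?q))"
          using p w ab by auto
        ultimately have "cycle ?q" unfolding cycle_def by blast
        from no_cycle[OF this] \<open>p \<noteq> []\<close> show False by (cases p) auto
      qed
      have path_b: "\<exists>p. apath b p u \<and> set (pawalk_verts b p) \<subseteq> insert b W" if u: "u \<in> W" for u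
      proof -
        obtain p where p: "apath a p u" "set (pawalk_verts a p) \<subseteq> W"
          using less.prems(4) u ab unfolding pathconn_def by meson
        then have "apath b ((b, a) # p) u" using ba bV ab by (auto simp: apath_simps)
        then show ?thesis using p by (intro exI[of _ "(b, a) # p"]) auto
      qed
      have path_b': "\<exists>p. apath u p b \<and> set (pawalk_verts u p) \<subseteq> insert b W" if u: "u \<in> W" for u
      proof -
        obtain p where p: "apath b p u" "set (pawalk_verts b p) \<subseteq> insert b W"
          using path_b[OF u] by blast
        then have "awalk b p u" by (simp add: apath_def)
        then show ?thesis using p awalk_verts_rev_path[of b p u]
          by (intro exI[of _ "rev_path p"]) auto
      qed
      have "pathconn (insert b W)"
        unfolding pathconn_def
      proof (intro ballI)
        fix u v assume uv: "u \<in> insert b W" "v \<in> insert b W"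
        show "\<exists>p. apath u p v \<and> set (pawalk_verts u p) \<subseteq> insert b W"
        proof (cases "u = b")
          case True
          show ?thesis
          proof (cases "v = b")
            case True
            then show ?thesis using \<open>u = b\<close> bV by (intro exI[of _ "[]"]) (auto simp: apath_Nil_iff)
          next
            case False
            then show ?thesis using uv \<open>u = b\<close> path_b by auto
          qed
        next
          case False
          then show ?thesis
            using uv path_b' less.prems(4) by (cases "v = b") (auto simp: pathconn_def, blast)
        qed
      qed
      moreover have "P (insert b W)"
        using insert[of W a b] uniq less.prems ab bV by blast
      moreover have "card (pverts T - insert b W) < card (pverts T - W)"
        using bV ab pair_finite_verts by (intro psubset_card_mono) auto
      ultimately show ?thesis using less.hyps[of "insert b W"] less.prems bV by auto
    qed
  qed
  obtain r where r: "r \<in> pverts T" using conn by (auto simp: strongly_connected_def)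
  have "pathconn {r}"
    using r by (auto simp: pathconn_def apath_Nil_iff intro!: exI[of _ "[]"])
  then show ?thesis using extend[of "{r}"] singleton r by auto
qed

section \<open>Edge colours, shades and sides on the tree\<close>

text \<open>
  \<open>\<phi>\<close> is a proper edge colouring, \<open>\<sigma> a k\<close> is the shade that the vertex \<open>a\<close> assigns to
  the colour \<open>k\<close>, and \<open>\<pi>\<close> is a bipartition, all on the subgraph induced by \<open>W\<close>.
\<close>

definition flip_colouring ::
    "'a pair_pre_digraph \<Rightarrow> 'a set \<Rightarrow> ('a set \<Rightarrow> nat) \<Rightarrow> ('a \<Rightarrow> nat \<Rightarrow> bool) \<Rightarrow> ('a \<Rightarrow> bool) \<Rightarrow> bool" where
  "flip_colouring T W \<phi> \<sigma> \<pi> \<longleftrightarrow>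
    (\<forall>a\<in>W. \<forall>b\<in>W. (a, b) \<in> parcs T \<longrightarrow> \<phi> {a, b} < max_degree T \<and>
      (\<forall>c\<in>W. (a, c) \<in> parcs T \<and> b \<noteq> c \<longrightarrow> \<phi> {a, b} \<noteq> \<phi> {a, c}) \<and>
      (\<forall>k. \<sigma> a k = \<sigma> b k \<longleftrightarrow> k = \<phi> {a, b}) \<and> \<pi> a \<noteq> \<pi> b)"

text \<open>A new leaf \<open>b\<close> meets only the edge to \<open>a\<close>. A colour is free at
  \<open>a\<close>, and the shades and the side of \<open>b\<close> are then forced by those of
  \<open>a\<close>, with no other edge to contradict them.\<close>

lemma undirected_tree_flip_colouring:
  assumes T: "undirected_tree T"
  shows "\<exists>\<phi> \<sigma> \<pi>. flip_colouring T (pverts T) \<phi> \<sigma> \<pi>"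
proof -
  interpret pair_graph T using T by (simp add: undirected_tree_def)
  show ?thesis
    using T
  proof (induction rule: undirected_tree_induct)
    case (singleton r)
    then show ?case using no_loops' by (auto simp: flip_colouring_def)
  next
    case (insert W a b)
    then obtain \<phi> \<sigma> \<pi> where flip: "flip_colouring T W \<phi> \<sigma> \<pi>" by blast
    have IH:
        "\<And>x y. \<lbrakk>x \<in> W; y \<in> W; (x, y) \<in> parcs T\<rbrakk> \<Longrightarrow> \<phi> {x, y} < max_degree T"
        "\<And>x y z. \<lbrakk>x \<in> W; y \<in> W; (x, y) \<in> parcs T; z \<in> W; (x, z) \<in> parcs T; y \<noteq> z\<rbrakk>
          \<Longrightarrow> \<phi> {x, y} \<noteq> \<phi> {x, z}"
        "\<And>x y k. \<lbrakk>x \<in> W; y \<in> W; (x, y) \<in> parcs T\<rbrakk> \<Longrightarrow> \<sigma> x k = \<sigma> y k \<longleftrightarrow> k = \<phi> {x, y}"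
        "\<And>x y. \<lbrakk>x \<in> W; y \<in> W; (x, y) \<in> parcs T\<rbrakk> \<Longrightarrow> \<pi> x \<noteq> \<pi> y"
      using flip unfolding flip_colouring_def by blast+
    have W: "W \<subseteq> pverts T" "a \<in> W" "b \<notin> W" "(a, b) \<in> parcs T"
      and uniq: "\<And>c. \<lbrakk>c \<in> W; (c, b) \<in> parcs T\<rbrakk> \<Longrightarrow> c = a"
      using insert by blast+
    let ?N = "{c \<in> W. (a, c) \<in> parcs T}"
    have fin: "finite ?N" using W(1) pair_finite_verts by (simp add: finite_subset)
    \<comment> \<open>The leaf \<open>b\<close> is a neighbour of \<open>a\<close> outside
      \<open>W\<close>, so fewer than \<open>max_degree T\<close> colours are in use at
      \<open>a\<close>.\<close>
    have "Suc (card ?N) = card (Pair a ` insert b ?N)"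
      using W(3) fin by (subst card_image) (auto simp: inj_on_def)
    also have "\<dots> \<le> out_degree (with_proj T) a"
      unfolding out_degree_def using W(4)
      by (intro card_mono finite_out_arcs) (auto simp: out_arcs_def)
    also have "\<dots> \<le> max_degree T"
      unfolding max_degree_def using pair_finite_verts W(1,2) by (intro Max_ge) auto
    finally have "card ((\<lambda>c. \<phi> {a, c}) ` ?N) < card {..<max_degree T}"
      using card_image_le[OF fin, of "\<lambda>c. \<phi> {a, c}"] by simp
    then have "\<not> {..<max_degree T} \<subseteq> (\<lambda>c. \<phi> {a, c}) ` ?N"
      using fin by (meson card_mono finite_imageI not_le)
    then obtain j where j: "j < max_degree T" "j \<notin> (\<lambda>c. \<phi> {a, c}) ` ?N"
      by blast
    then have j_new: "\<phi> {a, c} \<noteq> j" if "c \<in> W" "(a, c) \<in> parcs T" for c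
      using that by blast
    define \<phi>' where "\<phi>' = \<phi>({a, b} := j)"
    define \<sigma>' where "\<sigma>' = \<sigma>(b := \<lambda>k. if k = j then \<sigma> a k else \<not> \<sigma> a k)"
    define \<pi>' where "\<pi>' = \<pi>(b := \<not> \<pi> a)"
    have old: "\<phi>' {x, y} = \<phi> {x, y}" if "x \<in> W" "y \<in> W" for x y
      using that W(3) by (auto simp: \<phi>'_def doubleton_eq_iff)
    have new: "\<phi>' {a, b} = j" "\<phi>' {b, a} = j"
      by (auto simp: \<phi>'_def insert_commute)
    have bb: "(b, b) \<notin> parcs T" using no_loops' by blast
    have nb: "c = a" if "c \<in> W" "(c, b) \<in> parcs T \<or> (b, c) \<in> parcs T" for c
      using that uniq arcs_symmetric by blast
    have "b \<noteq> a" "b \<notin> W" using W(2,3) by auto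
    have cases: "(x \<in> W \<and> y \<in> W) \<or> (x = a \<and> y = b) \<or> (x = b \<and> y = a)"
      if "x \<in> insert b W" "y \<in> insert b W" "(x, y) \<in> parcs T" for x y
      using that nb bb by blast
    show ?case
      unfolding flip_colouring_def
    proof (intro exI[of _ \<phi>'] exI[of _ \<sigma>'] exI[of _ \<pi>'] ballI impI conjI allI)
      fix x y assume xy: "x \<in> insert b W" "y \<in> insert b W" "(x, y) \<in> parcs T"
      note c = cases[OF this]
      show "\<phi>' {x, y} < max_degree T"
        using c xy(3) IH(1)[of x y] old new j by auto
      show "\<pi>' x \<noteq> \<pi>' y"
        using c xy(3) IH(4)[of x y] \<open>b \<noteq> a\<close> \<open>b \<notin> W\<close> by (auto simp: \<pi>'_def)
      show "\<sigma>' x k = \<sigma>' y k \<longleftrightarrow> k = \<phi>' {x, y}" for k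
        using c xy(3) IH(3)[of x y k] old new \<open>b \<noteq> a\<close> \<open>b \<notin> W\<close> by (auto simp: \<sigma>'_def)
      fix z assume z: "z \<in> insert b W" "(x, z) \<in> parcs T \<and> y \<noteq> z"
      show "\<phi>' {x, y} \<noteq> \<phi>' {x, z}"
        using c cases[of x z] z xy(3) IH(2)[of x y z] W(2) old new j_new[of y] j_new[of z] \<open>b \<noteq> a\<close> \<open>b \<notin> W\<close> by auto
    qed
  qed
qed

section \<open>The cyclic word on five letters\<close>

text \<open>Within a run of equal blocks, \<open>d\<close> is not a multiple of the period. Across a
  border, a block of length L gives the letter L + e - d before it and e after it; these differ
  since d < 4 \<le> L.\<close>

lemma cyclic_word_window4:
  fixes p q :: nat
  assumes "n = 4 * p + 5 * q"
  obtains w :: "nat \<Rightarrow> nat" where "\<And>m. w m < 5"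
    and "\<And>m d. \<lbrakk>m < n; d \<in> {1, 2, 3}\<rbrakk> \<Longrightarrow> w m \<noteq> w ((m + d) mod n)"
proof
  define w :: "nat \<Rightarrow> nat" where "w m = (if m < 4 * p then m mod 4 else (m - 4 * p) mod 5)" for m
  show "w m < 5" for m
    using mod_less_divisor[of 4 m] mod_less_divisor[of 5 "m - 4 * p"] unfolding w_def by auto
  show "w m \<noteq> w ((m + d) mod n)" if "m < n" "d \<in> {1, 2, 3}" for m d
  proof (cases "m + d < n")
    case True
    have mod4: "(i + d) mod 4 \<noteq> i mod 4" and mod5: "(i + d) mod 5 \<noteq> i mod 5" for i
      using that(2) by (elim insertE emptyE; presburger)+
    consider "m + d < 4 * p" | "m < 4 * p" "4 * p \<le> m + d" | "4 * p \<le> m" by linarith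
    then show ?thesis
    proof cases
      case 1
      then show ?thesis using True mod4[of m] by (simp add: w_def)
    next
      case 2
      \<comment> \<open>The offset \<open>e\<close> past the border is at most 2, so it is itself
        the letter there.\<close>
      define e where "e = m + d - 4 * p"
      have e: "m + d = 4 * p + e" "e < d" "d < 4" using 2 that by (auto simp: e_def)
      then have "m = 4 * (p - 1) + (4 + e - d)" using 2 by auto
      then have "m mod 4 = 4 + e - d" using e by (simp only: mod_mult_self4) simp
      then have "w m = 4 + e - d" using 2 by (simp add: w_def)
      moreover have "w ((m + d) mod n) = e" using 2 e True by (simp add: w_def)
      ultimately show ?thesis using e by simp
    next
      case 3
      then show ?thesis using True mod5[of "m - 4 * p"] by (simp add: w_def)
    qed
  next
    case False
    define e where "e = m + d - n"
    have e: "m + d = n + e" "e < d" "d < 4" using False that by (auto simp: e_def)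
    have "0 < p \<or> 0 < q" using assms that(1) by auto
    then have "4 \<le> n" "e < 4 * p \<or> p = 0" using assms e by auto
    then have "(m + d) mod n = e" using e by simp
    then have wrap: "w ((m + d) mod n) = e"
      using \<open>e < 4 * p \<or> p = 0\<close> e by (auto simp: w_def)
    \<comment> \<open>Both kinds of block start with 0, 1, 2, so only the last block matters: its
      length is 4 if \<open>q = 0\<close> and 5 otherwise.\<close>
    show ?thesis
    proof (cases q)
      case 0
      then have "m = 4 * (p - 1) + (4 + e - d)" "m < 4 * p" using e that assms by auto
      moreover from this have "m mod 4 = 4 + e - d" using e by (simp only: mod_mult_self4) simp
      ultimately have "w m = 4 + e - d" by (simp add: w_def)
      then show ?thesis using wrap e by simp
    next
      case (Suc q')
      then have "m - 4 * p = 5 * q' + (5 + e - d)" "\<not> m < 4 * p" using e assms by auto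
      moreover from this have "(m - 4 * p) mod 5 = 5 + e - d"
        using e by (simp only: mod_mult_self4) simp
      ultimately have "w m = 5 + e - d" by (simp add: w_def)
      then show ?thesis using wrap e by simp
    qed
  qed
qed

section \<open>Colouring the product\<close>

theorem theorem11:
  fixes T :: "'a pair_pre_digraph" and l :: nat
  assumes "undirected_tree T" and "3 < l"
  shows "strong_chromatic_index (T \<box> cycle_graph (2 * l)) \<le> 2 * max_degree T + 5"
proof -
  interpret T: pair_graph T using assms by (simp add: undirected_tree_def)
  define n where "n = 2 * l"
  have n: "8 \<le> n" "even n" using assms by (auto simp: n_def)
  define s where "s i = (i + 1) mod n" for i
  have s_less: "s i < n" for i using n by (simp add: s_def)
  have s_inj: "s i = s j \<longleftrightarrow> i = j" if "i < n" "j < n" for i j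
    using that n by (auto simp: s_def mod_Suc split: if_splits)
  \<comment> \<open>Here the even length of the cycle enters: level parity alternates all the way
    round.\<close>
  have s_even: "even (s i) \<noteq> even i" if "i < n" for i
    using that n by (auto simp: s_def mod_Suc)
  have s_ss: "s (s i) \<noteq> i" if "i < n" for i
    using that n by (auto simp: s_def mod_Suc split: if_splits)
  \<comment> \<open>An even \<open>n \<ge> 8\<close> is a multiple of 4, or is 2 modulo 4 and at
    least 10; two blocks of length 5 correct the remainder.\<close>
  obtain p q where "n = 4 * p + 5 * q"
  proof (cases "4 dvd n")
    case True
    then show ?thesis using that[of "n div 4" 0] by simp
  next
    case False
    with n have "n = 4 * ((n - 10) div 4) + 5 * 2" by presburger
    then show ?thesis using that by blast
  qed
  then obtain w where w5: "\<And>m. w m < (5 :: nat)"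
    and w: "\<And>m d. \<lbrakk>m < n; d \<in> {1, 2, 3}\<rbrakk> \<Longrightarrow> w m \<noteq> w ((m + d) mod n)"
    using cyclic_word_window4 by metis
  have ws: "w m \<noteq> w (s m)" "w m \<noteq> w (s (s m))" "w m \<noteq> w (s (s (s m)))" if "m < n" for m
    using w[OF that, of 1] w[OF that, of 2] w[OF that, of 3]
    by (simp_all add: s_def mod_Suc_eq numeral_2_eq_2 numeral_3_eq_3)
  obtain \<phi> \<sigma> \<pi> where flip: "flip_colouring T (pverts T) \<phi> \<sigma> \<pi>"
    using undirected_tree_flip_colouring[OF assms(1)] by blast
  have \<phi>: "\<And>a b. (a, b) \<in> parcs T \<Longrightarrow> \<phi> {a, b} < max_degree T"
    "\<And>a b c. \<lbrakk>(a, b) \<in> parcs T; (a, c) \<in> parcs T; b \<noteq> c\<rbrakk> \<Longrightarrow> \<phi> {a, b} \<noteq> \<phi> {a, c}"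
    and \<sigma>: "\<And>a b k. (a, b) \<in> parcs T \<Longrightarrow> \<sigma> a k = \<sigma> b k \<longleftrightarrow> k = \<phi> {a, b}"
    and \<pi>: "\<And>a b. (a, b) \<in> parcs T \<Longrightarrow> \<pi> a \<noteq> \<pi> b"
    using flip T.in_arcsD1 T.in_arcsD2 unfolding flip_colouring_def by blast+
  define x where "x a m = (if \<pi> a then w m else w (s (s m)))" for a m
  \<comment> \<open>The index of a cycle edge is the end \<open>m\<close> for which the edge is
    \<open>{m, s m}\<close>.\<close>
  define ix where "ix i j = (if j = s i then i else j)" for i j
  \<comment> \<open>Colour and shade bit are packed into one number below
    \<open>2 * max_degree T\<close>. Both ends of an edge assign the same shade to its own colour,
    so \<open>t\<close> is symmetric in \<open>a\<close> and \<open>b\<close>. In \<open>f\<close>,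
    the cycle edges use the range above.\<close>
  define t where "t i a b = 2 * \<phi> {a, b} + of_bool (\<sigma> a (\<phi> {a, b}) = even i)" for i :: nat and a b
  define f where "f u v = (case u of (a, i) \<Rightarrow> case v of (b, j) \<Rightarrow>
     if i = j then t i a b else 2 * max_degree T + x a (ix i j))" for u v
  define C where "C i j \<longleftrightarrow> i < n \<and> j < n \<and> (j = s i \<or> i = s j)" for i j
  have arcs: "((a, i), (b, j)) \<in> parcs (T \<box> cycle_graph (2 * l)) \<longleftrightarrow>
    a \<in> pverts T \<and> b \<in> pverts T \<and> i < n \<and> j < n \<and> (a = b \<and> C i j \<or> i = j \<and> (a, b) \<in> parcs T)"
    for a b i j
    by (auto simp: cartesian_product_def cycle_graph_def C_def s_def n_def)
  have C_neq: "i \<noteq> j" if "C i j" for i j using that s_even[of i] s_even[of j] by (auto simp: C_def)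
  have loop: "(a, a) \<notin> parcs T" for a using T.no_loops' by blast
  have C_sym: "C j i \<and> ix j i = ix i j" if "C i j" for i j
    using that s_ss[of i] s_ss[of j] by (auto simp: C_def ix_def)
  have ix: "ix i j < n \<and> (i = ix i j \<and> j = s (ix i j) \<or> i = s (ix i j) \<and> j = ix i j)"
    if "C i j" for i j
    using that s_ss[of i] s_ss[of j] by (auto simp: C_def ix_def)
  have C_even: "even i \<noteq> even j" if "C i j" for i j
    using that s_even[of i] s_even[of j] by (auto simp: C_def)
  have t_sym: "t i a b = t i b a" if "(a, b) \<in> parcs T" for i a b
    using \<sigma>[OF that, of "\<phi> {a, b}"] by (simp add: t_def insert_commute)
  have t_less: "t i a b < 2 * max_degree T" if "(a, b) \<in> parcs T" for i a b
    using \<phi>(1)[OF that] by (auto simp: t_def)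
  have t_eq: "\<phi> {a, b} = \<phi> {c, d} \<and> ((\<sigma> a (\<phi> {a, b}) = even i) = (\<sigma> c (\<phi> {c, d}) = even j))"
    if "t i a b = t j c d" for i j a b c d
  proof -
    have "x = y \<and> P = Q" if "2 * x + of_bool P = 2 * y + of_bool Q" for x y :: nat and P Q
      using that by (cases P; cases Q) (simp; presburger)+
    from this[OF that[unfolded t_def]] show ?thesis .
  qed
  \<comment> \<open>Shifting a whole word preserves differences, so indices at most two apart get
    distinct letters.\<close>
  have x_same: "m = m'" if "x a m = x a m'" "m < n" "m' < n"
    "m' \<in> {m, s m, s (s m)} \<or> m \<in> {m', s m', s (s m')}" for a m m'
    using that ws s_less unfolding x_def by (auto split: if_splits) metis+
  \<comment> \<open>The relative shift by two turns index differences -1, 0, 1 into 1, 2, 3.\<close>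
  have x_adj: False if "x a m = x b m'" "m < n" "m' < n" "(a, b) \<in> parcs T"
    "m' \<in> {m, s m} \<or> m \<in> {m', s m'}" for a b m m'
    using that ws[of m] ws[of m'] ws(1)[of "s m"] ws(1)[of "s m'"] s_less \<pi>[OF that(4)]
    by (auto simp: x_def split: if_splits)
  show ?thesis
  proof (rule strong_chromatic_index_leI[where f = f])
    show "pair_graph (T \<box> cycle_graph (2 * l))"
      using assms by (intro pair_graph_cartesian_product pair_graph_cycle_graph T.pair_graph) auto
  next
    fix u v assume uv: "(u, v) \<in> parcs (T \<box> cycle_graph (2 * l))"
    obtain a i b j where u: "u = (a, i)" "v = (b, j)" by (cases u; cases v)
    then consider "i = j" "(a, b) \<in> parcs T" | "a = b" "C i j" using uv arcs by auto
    then have "f u v = f v u \<and> f u v < 2 * max_degree T + 5"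
    proof cases
      case 1
      then show ?thesis using t_sym[of a b i] t_less[of a b i] by (simp add: f_def u)
    next
      case 2
      then show ?thesis using C_sym[of i j] C_neq[of i j] w5 by (auto simp: f_def u x_def)
    qed
    then show "f u v = f v u" "f u v < 2 * max_degree T + 5" by auto
  next
    fix u v u' v'
    assume uv: "(u, v) \<in> parcs (T \<box> cycle_graph (2 * l))"
      and uv': "(u', v') \<in> parcs (T \<box> cycle_graph (2 * l))"
      and uu': "u = u' \<or> (u, u') \<in> parcs (T \<box> cycle_graph (2 * l))"
      and eq: "f u v = f u' v'"
    obtain a i b j where u: "u = (a, i)" "v = (b, j)" by (cases u; cases v)
    obtain a' i' b' j' where u': "u' = (a', i')" "v' = (b', j')" by (cases u'; cases v')
    have near: "a = a' \<and> i = i' \<or> a = a' \<and> C i i' \<or> i = i' \<and> (a, a') \<in> parcs T"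
      using uu' by (auto simp: u u' arcs)
    consider (TT) "i = j" "(a, b) \<in> parcs T" "i' = j'" "(a', b') \<in> parcs T"
      | (TC) "i = j" "(a, b) \<in> parcs T" "a' = b'" "C i' j'"
      | (CT) "a = b" "C i j" "i' = j'" "(a', b') \<in> parcs T"
      | (CC) "a = b" "C i j" "a' = b'" "C i' j'"
      using uv uv' by (auto simp: u u' arcs)
    then show "{u, v} = {u', v'}"
    proof cases
      case TT
      then have "t i a b = t i' a' b'" using eq by (simp add: f_def u u')
      note t = t_eq[OF this]
      show ?thesis
      proof (cases "a = a'")
        case True
        \<comment> \<open>Properness at the common vertex leaves two copies of one edge; equal
          shades give levels of equal parity, hence not consecutive ones.\<close>
        then have "b = b'" using t TT \<phi>(2) by metis
        then have "even i = even i'" using t True by auto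
        then show ?thesis using near C_even loop True \<open>b = b'\<close> TT by (auto simp: u u')
      next
        case False
        then have aa': "i = i'" "(a, a') \<in> parcs T" using near by auto
        \<comment> \<open>At one level, equal shades mean that \<open>\<sigma> a\<close> and
          \<open>\<sigma> a'\<close> agree at the common colour, so it is the colour of the edge
          \<open>aa'\<close>. Properness at \<open>a\<close> and at \<open>a'\<close> then
          identifies both edges with \<open>aa'\<close>.\<close>
        then have "\<phi> {a, b} = \<phi> {a, a'}" using t \<sigma> by metis
        then have "b = a'" "\<phi> {a', b'} = \<phi> {a', a}"
          using \<phi>(2) aa' TT t by (metis, metis insert_commute)
        moreover have "b' = a"
          using \<phi>(2) aa' TT calculation T.arcs_symmetric by metis
        ultimately show ?thesis using aa' TT by (auto simp: u u')
      qed
    next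
      case TC
      then show ?thesis using eq t_less[of a b i] C_neq by (auto simp: f_def u u')
    next
      case CT
      then show ?thesis using eq t_less[of a' b' i'] C_neq by (auto simp: f_def u u')
    next
      case CC
      define m m' where "m = ix i j" and "m' = ix i' j'"
      have m: "m < n" "i = m \<and> j = s m \<or> i = s m \<and> j = m"
        and m': "m' < n" "i' = m' \<and> j' = s m' \<or> i' = s m' \<and> j' = m'"
        using ix[OF CC(2)] ix[OF CC(4)] by (auto simp: m_def m'_def)
      have x_eq: "x a m = x a' m'"
        using eq CC C_neq by (auto simp: f_def u u' m_def m'_def)
      show ?thesis
      proof (cases "a = a'")
        case True
        \<comment> \<open>First ends at most one level apart give indices at most two apart.\<close>
        then have "i = i' \<or> i' = s i \<or> i = s i'" using near loop by (auto simp: C_def)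
        then have "m' \<in> {m, s m, s (s m)} \<or> m \<in> {m', s m', s (s m')}"
          using m m' by (elim disjE conjE; simp add: s_inj s_less)
        then have "m = m'" using x_same[of a m m'] x_eq m(1) m'(1) True by blast
        then show ?thesis using m(2) m'(2) CC True unfolding u u' by (auto simp: insert_commute)
      next
        case False
        \<comment> \<open>First ends at the same level give indices at most one apart.\<close>
        then have "i = i'" "(a, a') \<in> parcs T" using near by auto
        moreover from this have "m' \<in> {m, s m} \<or> m \<in> {m', s m'}"
          using m m' by (elim disjE conjE; simp add: s_inj s_less)
        ultimately show ?thesis using x_adj[of a m a' m'] x_eq m(1) m'(1) by blast
      qed
    qed
  qed
qed

end
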